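(* Let $\Sigma$ be an aggregate signature, $\mathcal D$ a $\Sigma$-structure, $\Pi$ a set of defined predicate symbols and $P$ a definite $\Sigma(\Pi)$-aggregate program. Then $P$ has a two-valued $ult$-well-founded model $(M,M)$, $M$ is the unique $ult$-stable model of $P$, and $M$ is the least fixpoint of $T_{P,\mathcal D}$.
   Context: Aggregates: an aggregate relation is $R\subseteq\mathcal P(D_1)\times D_2$; it is monotone if $(S_1,d)\in R$, $S_1\subseteq S_2$ imply $(S_2,d)\in R$, anti-monotone if $(S_2,d)\in R$, $S_1\subseteq S_2$ imply $(S_1,d)\in R$. An aggregate signature $\Sigma$ has sorts, sorted function, predicate and aggregate symbols $\mathsf R:\{s_1\times\dots\times s_n\}\times w$. Set expressions $\{(x_1,\dots,x_n)\mid\varphi\}$, aggregate atoms $\mathsf R(s,t)$ and aggregate formulas (atoms, aggregate atoms, closed under $\neg,\wedge,\vee,\forall,\exists$) are defined simultaneously. A $\Sigma$-structure interprets symbols as usual, aggregate symbols by aggregate relations; the value of $\{\bar x\mid\varphi(\bar x)\}$ is $\{\bar d\mid \mathcal D\models\varphi(\bar d)\}$ and $\mathsf R(s,t)$ holds iff (value of $s$, value of $t$) $\in\mathsf R^{\mathcal D}$. Programs: $\Pi$ is a set of predicate symbols not in $\Sigma$; a rule is $A\leftarrow\varphi$, $A$ an atom with predicate in $\Pi$, $\varphi$ a $\Sigma(\Pi)$-aggregate formula; a program is a set of rules. Interpretations are subsets $I$ of $base_{\mathcal D}(\Pi)$ (ground atoms of $\Pi$ over domain elements), ordered by $\subseteq$;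 $\mathcal D(I)$ makes exactly the atoms in $I$ true. $inst_{\mathcal D}(P)$ is the set of ground instances of rules of $P$ (domain elements substituted for free variables, head terms evaluated). $T_{P,\mathcal D}(I)=\{A\mid A\leftarrow\varphi\in inst_{\mathcal D}(P),\ \mathcal D(I)\models\varphi\}$. Definite programs: an occurrence of a predicate in a formula is neutral if it lies inside the condition $\theta$ of an aggregate atom $\mathsf R(\{\bar x\mid\theta\},t)$ with $\mathsf R^{\mathcal D}$ neither monotone nor anti-monotone; otherwise it is positive (resp. negative) if the number of negations and of aggregate atoms interpreted by anti-monotone aggregate relations above it is even (resp. odd). A formula is positive if no predicate of $\Pi$ occurs negatively or neutrally in it. A definite aggregate program is one whose rule bodies are all positive. Three-valued semantics: $\mathbf{THREE}=\{(\mathbf f,\mathbf f),(\mathbf f,\mathbf t),(\mathbf t,\mathbf t)\}$ (false, unknown, true), truth order componentwise with meet $\wedge$ and join $\vee$, $\neg(x,y)=(\neg y,\neg x)$. A three-valued set is a pair $(S_1,S_2)$ with $S_1\subseteq S_2$. For an aggregate relation $R$, $ult(R)$ maps $((S_1,S_2),d)$ to $(x,y)$ with $x=\mathbf t$ iff $(S,d)\in R$ for all $S$ with $S_1\subseteq S\subseteq S_2$, and $y=\mathbf t$ iff $(S,d)\in R$ for some such $S$. A three-valued interpretation is a pair $(I_1,I_2)$ of interpretations, $I_1\subseteq I_2$, giving defined atom $A$ the value $(A\in I_1,A\in I_2)$. The value $\mathcal H_{ult(I_1,I_2)}(\varphi)$ of a closed formula: $\Sigma$-atoms as in $\mathcal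 D$, defined atoms by $(I_1,I_2)$, connectives and quantifiers by the $\mathbf{THREE}$ operations (quantifiers as join/meet over domain), a set expression $\{\bar x\mid\psi\}$ evaluates to $(S_1,S_2)$ where $S_1$ (resp. $S_2$) is the set of tuples with $\psi(\bar d)$ true (resp. not false), and $\mathsf R(s,t)$ evaluates to $ult(\mathsf R^{\mathcal D})$ applied to the values. $\Phi_{P,ult}(I_1,I_2)$ assigns each $A\in base_{\mathcal D}(\Pi)$ the join of the values of bodies of rules $A\leftarrow\varphi\in inst_{\mathcal D}(P)$ (false if none). The $ult$-well-founded model and $ult$-stable models are the well-founded fixpoint and exact stable fixpoints of $\Phi_{P,ult}$, where for an operator $A$ on pairs $(x,y)$, $x\le y$, of a complete lattice: $A^\downarrow(b)=\mathrm{glb}\{x\le b\mid A^1(x,b)\le x\}$, $A^\uparrow(a)=\mathrm{glb}\{x\ge a\mid A^2(a,x)\le x\}$, $\mathcal S_A(a,b)=(A^\downarrow(b),A^\uparrow(a))$; the well-founded fixpoint is the least fixpoint in the precision order ($(x,y)\le_p(x',y')$ iff $x\le x'$, $y'\le y$) of $\mathcal S_A$ on the pairs $(a,b)$ with $(a,b)\le_p A(a,b)$ and $a\le A^\downarrow(b)$; an exact stable fixpoint is an $x$ with $\mathcal S_A(x,x)=(x,x)$. *)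

theory Defs
  imports "HOL-Algebra.Complete_Lattice" "HOL-Library.Product_Order" "HOL-Library.FuncSet"
begin

section \<open>Syntax\<close>

text \<open>Symbols are given by partial maps to their sorts: \<open>sig_funs \<Sigma> f = Some (ss, w)\<close> reads
  \<open>f : s\<^sub>1 \<times> \<dots> \<times> s\<^sub>n \<rightarrow> w\<close>, and \<open>sig_aggs \<Sigma> R = Some (ss, w)\<close> reads \<open>R : {s\<^sub>1 \<times> \<dots> \<times> s\<^sub>n} \<times> w\<close>.\<close>

record ('s, 'f, 'p, 'r) aggsig =
  sig_sorts :: "'s set"
  sig_funs :: "'f \<rightharpoonup> 's list \<times> 's"
  sig_preds :: "'p \<rightharpoonup> 's list"
  sig_aggs :: "'r \<rightharpoonup> 's list \<times> 's"

definition aggregate_signature :: "('s, 'f, 'p, 'r) aggsig \<Rightarrow> bool" where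
  "aggregate_signature Sg \<longleftrightarrow>
    (\<forall>f ss w. sig_funs Sg f = Some (ss, w) \<longrightarrow> set ss \<subseteq> sig_sorts Sg \<and> w \<in> sig_sorts Sg) \<and>
    (\<forall>p ss. sig_preds Sg p = Some ss \<longrightarrow> set ss \<subseteq> sig_sorts Sg) \<and>
    (\<forall>r ss w. sig_aggs Sg r = Some (ss, w) \<longrightarrow> set ss \<subseteq> sig_sorts Sg \<and> w \<in> sig_sorts Sg)"

definition defined_predicates :: "('s, 'f, 'p, 'r) aggsig \<Rightarrow> ('p \<rightharpoonup> 's list) \<Rightarrow> bool" where
  "defined_predicates Sg Df \<longleftrightarrow>
    dom Df \<inter> dom (sig_preds Sg) = {} \<and> (\<forall>p ss. Df p = Some ss \<longrightarrow> set ss \<subseteq> sig_sorts Sg)"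

definition extend_sig ::
  "('s, 'f, 'p, 'r) aggsig \<Rightarrow> ('p \<rightharpoonup> 's list) \<Rightarrow> ('s, 'f, 'p, 'r) aggsig" where
  "extend_sig Sg Df = Sg\<lparr>sig_preds := sig_preds Sg ++ Df\<rparr>"

text \<open>A variable is a name together with its sort.\<close>

type_synonym 's var = "nat \<times> 's"

datatype ('s, 'f) tm = Var "'s var" | Fun 'f "('s, 'f) tm list"

datatype ('s, 'f, 'p, 'r) fm =
    Atom 'p "('s, 'f) tm list"
  | Agg 'r "('s, 'f, 'p, 'r) setexp" "('s, 'f) tm"
  | Neg "('s, 'f, 'p, 'r) fm"
  | Conj "('s, 'f, 'p, 'r) fm" "('s, 'f, 'p, 'r) fm"
  | Disj "('s, 'f, 'p, 'r) fm" "('s, 'f, 'p, 'r) fm"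
  | All "'s var" "('s, 'f, 'p, 'r) fm"
  | Ex "'s var" "('s, 'f, 'p, 'r) fm"
and ('s, 'f, 'p, 'r) setexp =
    SetExp "'s var list" "('s, 'f, 'p, 'r) fm"

inductive has_sort :: "('s, 'f, 'p, 'r) aggsig \<Rightarrow> ('s, 'f) tm \<Rightarrow> 's \<Rightarrow> bool"
  for Sg where
  "snd x \<in> sig_sorts Sg \<Longrightarrow> has_sort Sg (Var x) (snd x)"
| "sig_funs Sg f = Some (ss, w) \<Longrightarrow> list_all2 (has_sort Sg) ts ss \<Longrightarrow> has_sort Sg (Fun f ts) w"

primrec aggregate_formula :: "('s, 'f, 'p, 'r) aggsig \<Rightarrow> ('s, 'f, 'p, 'r) fm \<Rightarrow> bool"
  and set_expression :: "('s, 'f, 'p, 'r) aggsig \<Rightarrow> ('s, 'f, 'p, 'r) setexp \<Rightarrow> 's list \<Rightarrow> bool" where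
  "aggregate_formula Sg (Atom p ts) \<longleftrightarrow>
    (\<exists>ss. sig_preds Sg p = Some ss \<and> list_all2 (has_sort Sg) ts ss)"
| "aggregate_formula Sg (Agg r s t) \<longleftrightarrow>
    (\<exists>ss w. sig_aggs Sg r = Some (ss, w) \<and> set_expression Sg s ss \<and> has_sort Sg t w)"
| "aggregate_formula Sg (Neg \<phi>) \<longleftrightarrow> aggregate_formula Sg \<phi>"
| "aggregate_formula Sg (Conj \<phi> \<psi>) \<longleftrightarrow> aggregate_formula Sg \<phi> \<and> aggregate_formula Sg \<psi>"
| "aggregate_formula Sg (Disj \<phi> \<psi>) \<longleftrightarrow> aggregate_formula Sg \<phi> \<and> aggregate_formula Sg \<psi>"
| "aggregate_formula Sg (All x \<phi>) \<longleftrightarrow> snd x \<in> sig_sorts Sg \<and> aggregate_formula Sg \<phi>"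
| "aggregate_formula Sg (Ex x \<phi>) \<longleftrightarrow> snd x \<in> sig_sorts Sg \<and> aggregate_formula Sg \<phi>"
| "set_expression Sg (SetExp xs \<phi>) ss \<longleftrightarrow>
    distinct xs \<and> map snd xs = ss \<and> set ss \<subseteq> sig_sorts Sg \<and> aggregate_formula Sg \<phi>"

primrec fv_tm :: "('s, 'f) tm \<Rightarrow> 's var set" where
  "fv_tm (Var x) = {x}"
| "fv_tm (Fun f ts) = \<Union>(set (map fv_tm ts))"

primrec fv :: "('s, 'f, 'p, 'r) fm \<Rightarrow> 's var set"
  and fv_set :: "('s, 'f, 'p, 'r) setexp \<Rightarrow> 's var set" where
  "fv (Atom p ts) = (\<Union>t\<in>set ts. fv_tm t)"
| "fv (Agg r s t) = fv_set s \<union> fv_tm t"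
| "fv (Neg \<phi>) = fv \<phi>"
| "fv (Conj \<phi> \<psi>) = fv \<phi> \<union> fv \<psi>"
| "fv (Disj \<phi> \<psi>) = fv \<phi> \<union> fv \<psi>"
| "fv (All x \<phi>) = fv \<phi> - {x}"
| "fv (Ex x \<phi>) = fv \<phi> - {x}"
| "fv_set (SetExp xs \<phi>) = fv \<phi> - set xs"

text \<open>The rule \<open>p(ts) \<leftarrow> \<phi>\<close> is \<open>((p, ts), \<phi>)\<close>.\<close>

type_synonym ('s, 'f, 'p, 'r) rule = "('p \<times> ('s, 'f) tm list) \<times> ('s, 'f, 'p, 'r) fm"

fun fv_rule :: "('s, 'f, 'p, 'r) rule \<Rightarrow> 's var set" where
  "fv_rule ((p, ts), \<phi>) = (\<Union>t\<in>set ts. fv_tm t) \<union> fv \<phi>"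

definition aggregate_program ::
  "('s, 'f, 'p, 'r) aggsig \<Rightarrow> ('p \<rightharpoonup> 's list) \<Rightarrow> ('s, 'f, 'p, 'r) rule set \<Rightarrow> bool" where
  "aggregate_program Sg Df P \<longleftrightarrow>
    (\<forall>((p, ts), \<phi>)\<in>P. (\<exists>ss. Df p = Some ss \<and> list_all2 (has_sort Sg) ts ss) \<and>
      aggregate_formula (extend_sig Sg Df) \<phi>)"


section \<open>Structures and two-valued semantics\<close>

text \<open>All domains live in one type; \<open>sdom\<close> picks out the domain of each sort.\<close>

record ('s, 'f, 'p, 'r, 'd) struct =
  sdom :: "'s \<Rightarrow> 'd set"
  funI :: "'f \<Rightarrow> 'd list \<Rightarrow> 'd"
  predI :: "'p \<Rightarrow> 'd list set"
  aggI :: "'r \<Rightarrow> ('d list set \<times> 'd) set"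

definition tuples :: "('s, 'f, 'p, 'r, 'd) struct \<Rightarrow> 's list \<Rightarrow> 'd list set" where
  "tuples D ss = {ds. list_all2 (\<lambda>d s. d \<in> sdom D s) ds ss}"

definition is_struct ::
  "('s, 'f, 'p, 'r) aggsig \<Rightarrow> ('s, 'f, 'p, 'r, 'd) struct \<Rightarrow> bool" where
  "is_struct Sg D \<longleftrightarrow>
    (\<forall>f ss w. sig_funs Sg f = Some (ss, w) \<longrightarrow> funI D f \<in> tuples D ss \<rightarrow> sdom D w) \<and>
    (\<forall>p ss. sig_preds Sg p = Some ss \<longrightarrow> predI D p \<subseteq> tuples D ss) \<and>
    (\<forall>r ss w. sig_aggs Sg r = Some (ss, w) \<longrightarrow> aggI D r \<subseteq> Pow (tuples D ss) \<times> sdom D w)"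

definition monotone_agg :: "'a set \<Rightarrow> ('a set \<times> 'b) set \<Rightarrow> bool" where
  "monotone_agg D\<^sub>1 R \<longleftrightarrow>
    (\<forall>S\<^sub>1 S\<^sub>2 d. S\<^sub>2 \<subseteq> D\<^sub>1 \<longrightarrow> (S\<^sub>1, d) \<in> R \<longrightarrow> S\<^sub>1 \<subseteq> S\<^sub>2 \<longrightarrow> (S\<^sub>2, d) \<in> R)"

definition antimonotone_agg :: "'a set \<Rightarrow> ('a set \<times> 'b) set \<Rightarrow> bool" where
  "antimonotone_agg D\<^sub>1 R \<longleftrightarrow>
    (\<forall>S\<^sub>1 S\<^sub>2 d. S\<^sub>2 \<subseteq> D\<^sub>1 \<longrightarrow> (S\<^sub>2, d) \<in> R \<longrightarrow> S\<^sub>1 \<subseteq> S\<^sub>2 \<longrightarrow> (S\<^sub>1, d) \<in> R)"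

primrec eval :: "('s, 'f, 'p, 'r, 'd) struct \<Rightarrow> ('s var \<Rightarrow> 'd) \<Rightarrow> ('s, 'f) tm \<Rightarrow> 'd" where
  "eval D \<sigma> (Var x) = \<sigma> x"
| "eval D \<sigma> (Fun f ts) = funI D f (map (eval D \<sigma>) ts)"

definition update :: "('v \<Rightarrow> 'd) \<Rightarrow> 'v list \<Rightarrow> 'd list \<Rightarrow> 'v \<Rightarrow> 'd" where
  "update \<sigma> xs ds = (\<lambda>x. case map_of (zip xs ds) x of None \<Rightarrow> \<sigma> x | Some d \<Rightarrow> d)"

primrec sat ::
    "('s, 'f, 'p, 'r, 'd) struct \<Rightarrow> ('s, 'f, 'p, 'r) fm \<Rightarrow> ('s var \<Rightarrow> 'd) \<Rightarrow> bool"
  and set_val ::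
    "('s, 'f, 'p, 'r, 'd) struct \<Rightarrow> ('s, 'f, 'p, 'r) setexp \<Rightarrow> ('s var \<Rightarrow> 'd) \<Rightarrow> 'd list set" where
  "sat D (Atom p ts) \<sigma> \<longleftrightarrow> map (eval D \<sigma>) ts \<in> predI D p"
| "sat D (Agg r s t) \<sigma> \<longleftrightarrow> (set_val D s \<sigma>, eval D \<sigma> t) \<in> aggI D r"
| "sat D (Neg \<phi>) \<sigma> \<longleftrightarrow> \<not> sat D \<phi> \<sigma>"
| "sat D (Conj \<phi> \<psi>) \<sigma> \<longleftrightarrow> sat D \<phi> \<sigma> \<and> sat D \<psi> \<sigma>"
| "sat D (Disj \<phi> \<psi>) \<sigma> \<longleftrightarrow> sat D \<phi> \<sigma> \<or> sat D \<psi> \<sigma>"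
| "sat D (All x \<phi>) \<sigma> \<longleftrightarrow> (\<forall>d\<in>sdom D (snd x). sat D \<phi> (\<sigma>(x := d)))"
| "sat D (Ex x \<phi>) \<sigma> \<longleftrightarrow> (\<exists>d\<in>sdom D (snd x). sat D \<phi> (\<sigma>(x := d)))"
| "set_val D (SetExp xs \<phi>) \<sigma> = {ds \<in> tuples D (map snd xs). sat D \<phi> (update \<sigma> xs ds)}"

type_synonym ('p, 'd) interp = "('p \<times> 'd list) set"

definition base :: "('s, 'f, 'p, 'r, 'd) struct \<Rightarrow> ('p \<rightharpoonup> 's list) \<Rightarrow> ('p, 'd) interp" where
  "base D Df = {(p, ds). \<exists>ss. Df p = Some ss \<and> ds \<in> tuples D ss}"

definition interp_lattice ::
  "('s, 'f, 'p, 'r, 'd) struct \<Rightarrow> ('p \<rightharpoonup> 's list) \<Rightarrow> ('p, 'd) interp gorder" where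
  "interp_lattice D Df = \<lparr>carrier = Pow (base D Df), eq = (=), le = (\<subseteq>)\<rparr>"

definition extend_struct ::
  "('s, 'f, 'p, 'r, 'd) struct \<Rightarrow> ('p \<rightharpoonup> 's list) \<Rightarrow> ('p, 'd) interp \<Rightarrow>
    ('s, 'f, 'p, 'r, 'd) struct" where
  "extend_struct D Df I =
    D\<lparr>predI := (\<lambda>p. if p \<in> dom Df then {ds. (p, ds) \<in> I} else predI D p)\<rparr>"

text \<open>The ground instance of a rule obtained by substituting \<open>\<sigma>\<close> for its free variables is
  \<open>(A, \<phi>, \<sigma>)\<close>: the evaluated head \<open>A\<close>, and the closed body \<open>\<phi>\<sigma>\<close> represented by the
  pair of \<open>\<phi>\<close> and \<open>\<sigma>\<close>.\<close>

definition inst ::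
  "('s, 'f, 'p, 'r, 'd) struct \<Rightarrow> ('s, 'f, 'p, 'r) rule set \<Rightarrow>
    (('p \<times> 'd list) \<times> ('s, 'f, 'p, 'r) fm \<times> ('s var \<Rightarrow> 'd)) set" where
  "inst D P = {((p, map (eval D \<sigma>) ts), \<phi>, \<sigma>) | p ts \<phi> \<sigma>.
    ((p, ts), \<phi>) \<in> P \<and> \<sigma> \<in> (\<Pi>\<^sub>E x \<in> fv_rule ((p, ts), \<phi>). sdom D (snd x))}"

definition T_op ::
  "('s, 'f, 'p, 'r, 'd) struct \<Rightarrow> ('p \<rightharpoonup> 's list) \<Rightarrow> ('s, 'f, 'p, 'r) rule set \<Rightarrow>
    ('p, 'd) interp \<Rightarrow> ('p, 'd) interp" where
  "T_op D Df P I = {A. \<exists>\<phi> \<sigma>. (A, \<phi>, \<sigma>) \<in> inst D P \<and> sat (extend_struct D Df I) \<phi> \<sigma>}"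


section \<open>Definite programs\<close>

definition monotone_sym ::
  "('s, 'f, 'p, 'r) aggsig \<Rightarrow> ('s, 'f, 'p, 'r, 'd) struct \<Rightarrow> 'r \<Rightarrow> bool" where
  "monotone_sym Sg D r \<longleftrightarrow>
    (\<exists>ss w. sig_aggs Sg r = Some (ss, w) \<and> monotone_agg (tuples D ss) (aggI D r))"

definition antimonotone_sym ::
  "('s, 'f, 'p, 'r) aggsig \<Rightarrow> ('s, 'f, 'p, 'r, 'd) struct \<Rightarrow> 'r \<Rightarrow> bool" where
  "antimonotone_sym Sg D r \<longleftrightarrow>
    (\<exists>ss w. sig_aggs Sg r = Some (ss, w) \<and> antimonotone_agg (tuples D ss) (aggI D r))"

text \<open>\<open>(p, n, b) \<in> occs Sg D \<phi>\<close> iff \<open>p\<close> has an occurrence in \<open>\<phi>\<close> below exactly \<open>n\<close> negations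
  and anti-monotone aggregate atoms, where \<open>b\<close> tells whether the occurrence lies inside an
  aggregate atom that is neither monotone nor anti-monotone.\<close>

primrec occs ::
    "('s, 'f, 'p, 'r) aggsig \<Rightarrow> ('s, 'f, 'p, 'r, 'd) struct \<Rightarrow> ('s, 'f, 'p, 'r) fm \<Rightarrow>
      ('p \<times> nat \<times> bool) set"
  and occs_set ::
    "('s, 'f, 'p, 'r) aggsig \<Rightarrow> ('s, 'f, 'p, 'r, 'd) struct \<Rightarrow> ('s, 'f, 'p, 'r) setexp \<Rightarrow>
      ('p \<times> nat \<times> bool) set" where
  "occs Sg D (Atom p ts) = {(p, 0, False)}"
| "occs Sg D (Agg r s t) =
    (\<lambda>(p, n, b). (p, if antimonotone_sym Sg D r then Suc n else n,
        b \<or> \<not> monotone_sym Sg D r \<and> \<not> antimonotone_sym Sg D r)) ` occs_set Sg D s"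
| "occs Sg D (Neg \<phi>) = (\<lambda>(p, n, b). (p, Suc n, b)) ` occs Sg D \<phi>"
| "occs Sg D (Conj \<phi> \<psi>) = occs Sg D \<phi> \<union> occs Sg D \<psi>"
| "occs Sg D (Disj \<phi> \<psi>) = occs Sg D \<phi> \<union> occs Sg D \<psi>"
| "occs Sg D (All x \<phi>) = occs Sg D \<phi>"
| "occs Sg D (Ex x \<phi>) = occs Sg D \<phi>"
| "occs_set Sg D (SetExp xs \<phi>) = occs Sg D \<phi>"

definition occurs_neutrally where
  "occurs_neutrally Sg D p \<phi> \<longleftrightarrow> (\<exists>n. (p, n, True) \<in> occs Sg D \<phi>)"

definition occurs_negatively where
  "occurs_negatively Sg D p \<phi> \<longleftrightarrow> (\<exists>n. odd n \<and> (p, n, False) \<in> occs Sg D \<phi>)"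

definition positive_formula ::
  "('s, 'f, 'p, 'r) aggsig \<Rightarrow> ('s, 'f, 'p, 'r, 'd) struct \<Rightarrow> ('p \<rightharpoonup> 's list) \<Rightarrow>
    ('s, 'f, 'p, 'r) fm \<Rightarrow> bool" where
  "positive_formula Sg D Df \<phi> \<longleftrightarrow>
    (\<forall>p\<in>dom Df. \<not> occurs_negatively Sg D p \<phi> \<and> \<not> occurs_neutrally Sg D p \<phi>)"

definition definite_program ::
  "('s, 'f, 'p, 'r) aggsig \<Rightarrow> ('s, 'f, 'p, 'r, 'd) struct \<Rightarrow> ('p \<rightharpoonup> 's list) \<Rightarrow>
    ('s, 'f, 'p, 'r) rule set \<Rightarrow> bool" where
  "definite_program Sg D Df P \<longleftrightarrow>
    aggregate_program Sg Df P \<and> (\<forall>(A, \<phi>)\<in>P. positive_formula Sg D Df \<phi>)"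


section \<open>Three-valued semantics\<close>

text \<open>\<open>THREE\<close> is closed under arbitrary componentwise meets and joins, so its truth-order operations
  are those of the product lattice \<open>bool \<times> bool\<close>.\<close>

definition THREE :: "(bool \<times> bool) set" where
  "THREE = {(False, False), (False, True), (True, True)}"

fun neg3 :: "bool \<times> bool \<Rightarrow> bool \<times> bool" where
  "neg3 (x, y) = (\<not> y, \<not> x)"

definition ult :: "('a set \<times> 'b) set \<Rightarrow> ('a set \<times> 'a set) \<times> 'b \<Rightarrow> bool \<times> bool" where
  "ult R = (\<lambda>((S\<^sub>1, S\<^sub>2), d).
    (\<forall>S. S\<^sub>1 \<subseteq> S \<and> S \<subseteq> S\<^sub>2 \<longrightarrow> (S, d) \<in> R, \<exists>S. S\<^sub>1 \<subseteq> S \<and> S \<subseteq> S\<^sub>2 \<and> (S, d) \<in> R))"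

primrec H_ult ::
    "('s, 'f, 'p, 'r, 'd) struct \<Rightarrow> ('p \<rightharpoonup> 's list) \<Rightarrow> ('p, 'd) interp \<times> ('p, 'd) interp \<Rightarrow>
      ('s, 'f, 'p, 'r) fm \<Rightarrow> ('s var \<Rightarrow> 'd) \<Rightarrow> bool \<times> bool"
  and H_set ::
    "('s, 'f, 'p, 'r, 'd) struct \<Rightarrow> ('p \<rightharpoonup> 's list) \<Rightarrow> ('p, 'd) interp \<times> ('p, 'd) interp \<Rightarrow>
      ('s, 'f, 'p, 'r) setexp \<Rightarrow> ('s var \<Rightarrow> 'd) \<Rightarrow> 'd list set \<times> 'd list set" where
  "H_ult D Df II (Atom p ts) \<sigma> =
    (let ds = map (eval D \<sigma>) ts in
      if p \<in> dom Df then ((p, ds) \<in> fst II, (p, ds) \<in> snd II)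
      else (ds \<in> predI D p, ds \<in> predI D p))"
| "H_ult D Df II (Agg r s t) \<sigma> = ult (aggI D r) (H_set D Df II s \<sigma>, eval D \<sigma> t)"
| "H_ult D Df II (Neg \<phi>) \<sigma> = neg3 (H_ult D Df II \<phi> \<sigma>)"
| "H_ult D Df II (Conj \<phi> \<psi>) \<sigma> = inf (H_ult D Df II \<phi> \<sigma>) (H_ult D Df II \<psi> \<sigma>)"
| "H_ult D Df II (Disj \<phi> \<psi>) \<sigma> = sup (H_ult D Df II \<phi> \<sigma>) (H_ult D Df II \<psi> \<sigma>)"
| "H_ult D Df II (All x \<phi>) \<sigma> = (INF d\<in>sdom D (snd x). H_ult D Df II \<phi> (\<sigma>(x := d)))"
| "H_ult D Df II (Ex x \<phi>) \<sigma> = (SUP d\<in>sdom D (snd x). H_ult D Df II \<phi> (\<sigma>(x := d)))"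
| "H_set D Df II (SetExp xs \<phi>) \<sigma> =
    ({ds \<in> tuples D (map snd xs). H_ult D Df II \<phi> (update \<sigma> xs ds) = (True, True)},
     {ds \<in> tuples D (map snd xs). H_ult D Df II \<phi> (update \<sigma> xs ds) \<noteq> (False, False)})"

lemma H_in_THREE:
  fixes \<phi> :: "('s, 'f, 'p, 'r) fm" and s :: "('s, 'f, 'p, 'r) setexp"
    and D :: "('s, 'f, 'p, 'r, 'd) struct"
  assumes "I\<^sub>1 \<subseteq> I\<^sub>2"
  shows "H_ult D Df (I\<^sub>1, I\<^sub>2) \<phi> \<sigma> \<in> THREE"
    and "fst (H_set D Df (I\<^sub>1, I\<^sub>2) s \<sigma>) \<subseteq> snd (H_set D Df (I\<^sub>1, I\<^sub>2) s \<sigma>)"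
proof -
  have THREE: "v \<in> THREE \<longleftrightarrow> (fst v \<longrightarrow> snd v)" for v
    by (cases v) (auto simp: THREE_def)
  have ult: "fst (ult R (S, d)) \<longrightarrow> snd (ult R (S, d))" if "fst S \<subseteq> snd S"
    for R :: "('d list set \<times> 'd) set" and S d
    using that by (cases S) (auto simp: ult_def)
  have neg: "fst (neg3 v) \<longrightarrow> snd (neg3 v)" if "fst v \<longrightarrow> snd v" for v
    using that by (cases v) auto
  have "\<forall>\<sigma>. fst (H_ult D Df (I\<^sub>1, I\<^sub>2) \<phi> \<sigma>) \<longrightarrow> snd (H_ult D Df (I\<^sub>1, I\<^sub>2) \<phi> \<sigma>)"
    and "\<forall>\<sigma>. fst (H_set D Df (I\<^sub>1, I\<^sub>2) s \<sigma>) \<subseteq> snd (H_set D Df (I\<^sub>1, I\<^sub>2) s \<sigma>)"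
  proof (induction \<phi> and s)
    case (Atom p ts)
    then show ?case using assms by (auto simp: Let_def)
  next
    case (Agg r s t)
    then show ?case using ult by simp
  next
    case (Neg \<phi>)
    then show ?case using neg by simp
  next
    case (All x \<phi>)
    then show ?case by (simp add: fst_Inf snd_Inf image_image) blast
  next
    case (Ex x \<phi>)
    then show ?case by (simp add: fst_Sup snd_Sup image_image) blast
  qed auto
  then show "H_ult D Df (I\<^sub>1, I\<^sub>2) \<phi> \<sigma> \<in> THREE"
    and "fst (H_set D Df (I\<^sub>1, I\<^sub>2) s \<sigma>) \<subseteq> snd (H_set D Df (I\<^sub>1, I\<^sub>2) s \<sigma>)"
    unfolding THREE by blast+
qed

definition \<Phi>_ult ::
  "('s, 'f, 'p, 'r, 'd) struct \<Rightarrow> ('p \<rightharpoonup> 's list) \<Rightarrow> ('s, 'f, 'p, 'r) rule set \<Rightarrow>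
    ('p, 'd) interp \<times> ('p, 'd) interp \<Rightarrow> ('p, 'd) interp \<times> ('p, 'd) interp" where
  "\<Phi>_ult D Df P II =
    (let v = (\<lambda>A. Sup {H_ult D Df II \<phi> \<sigma> | \<phi> \<sigma>. (A, \<phi>, \<sigma>) \<in> inst D P}) in
      ({A \<in> base D Df. fst (v A)}, {A \<in> base D Df. snd (v A)}))"


section \<open>Well-founded and stable fixpoints of approximating operators\<close>

definition precision :: "'a gorder \<Rightarrow> ('a \<times> 'a) gorder" where
  "precision L =
    \<lparr>carrier = {(a, b). a \<in> carrier L \<and> b \<in> carrier L \<and> a \<sqsubseteq>\<^bsub>L\<^esub> b}, eq = (=),
     le = (\<lambda>(x, y) (x', y'). x \<sqsubseteq>\<^bsub>L\<^esub> x' \<and> y' \<sqsubseteq>\<^bsub>L\<^esub> y)\<rparr>"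

definition down :: "'a gorder \<Rightarrow> ('a \<times> 'a \<Rightarrow> 'a \<times> 'a) \<Rightarrow> 'a \<Rightarrow> 'a" where
  "down L A b = \<Sqinter>\<^bsub>L\<^esub>{x \<in> carrier L. x \<sqsubseteq>\<^bsub>L\<^esub> b \<and> fst (A (x, b)) \<sqsubseteq>\<^bsub>L\<^esub> x}"

definition up :: "'a gorder \<Rightarrow> ('a \<times> 'a \<Rightarrow> 'a \<times> 'a) \<Rightarrow> 'a \<Rightarrow> 'a" where
  "up L A a = \<Sqinter>\<^bsub>L\<^esub>{x \<in> carrier L. a \<sqsubseteq>\<^bsub>L\<^esub> x \<and> snd (A (a, x)) \<sqsubseteq>\<^bsub>L\<^esub> x}"

definition stable_op :: "'a gorder \<Rightarrow> ('a \<times> 'a \<Rightarrow> 'a \<times> 'a) \<Rightarrow> 'a \<times> 'a \<Rightarrow> 'a \<times> 'a" where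
  "stable_op L A = (\<lambda>(a, b). (down L A b, up L A a))"

definition well_founded_fixpoint :: "'a gorder \<Rightarrow> ('a \<times> 'a \<Rightarrow> 'a \<times> 'a) \<Rightarrow> 'a \<times> 'a \<Rightarrow> bool" where
  "well_founded_fixpoint L A w \<longleftrightarrow>
    least (precision L) w
      {(a, b) \<in> carrier (precision L).
        (a, b) \<sqsubseteq>\<^bsub>precision L\<^esub> A (a, b) \<and> a \<sqsubseteq>\<^bsub>L\<^esub> down L A b \<and> stable_op L A (a, b) = (a, b)}"

definition exact_stable_fixpoint :: "'a gorder \<Rightarrow> ('a \<times> 'a \<Rightarrow> 'a \<times> 'a) \<Rightarrow> 'a \<Rightarrow> bool" where
  "exact_stable_fixpoint L A x \<longleftrightarrow> x \<in> carrier L \<and> stable_op L A (x, x) = (x, x)"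

definition ult_well_founded_model ::
  "('s, 'f, 'p, 'r, 'd) struct \<Rightarrow> ('p \<rightharpoonup> 's list) \<Rightarrow> ('s, 'f, 'p, 'r) rule set \<Rightarrow>
    ('p, 'd) interp \<times> ('p, 'd) interp \<Rightarrow> bool" where
  "ult_well_founded_model D Df P = well_founded_fixpoint (interp_lattice D Df) (\<Phi>_ult D Df P)"

definition ult_stable_model ::
  "('s, 'f, 'p, 'r, 'd) struct \<Rightarrow> ('p \<rightharpoonup> 's list) \<Rightarrow> ('s, 'f, 'p, 'r) rule set \<Rightarrow>
    ('p, 'd) interp \<Rightarrow> bool" where
  "ult_stable_model D Df P = exact_stable_fixpoint (interp_lattice D Df) (\<Phi>_ult D Df P)"

end

theory Submission
  imports Defs
begin

text \<open>On a positive formula, three-valued evaluation in \<open>(I\<^sub>1, I\<^sub>2)\<close> splits into two-valued evaluation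
  in \<open>I\<^sub>1\<close> and in \<open>I\<^sub>2\<close>: an \<open>ult\<close> value of a monotone or anti-monotone aggregate is decided at the
  endpoints of the interval of sets, and below any other aggregate there are no defined predicates,
  so that interval is a single point. On negative formulas the components are swapped.
  Hence \<open>\<Phi>_ult (I\<^sub>1, I\<^sub>2) = (T I\<^sub>1, T I\<^sub>2)\<close>, and \<open>T\<close> is monotone because \<open>\<Phi>_ult\<close> maps consistent pairs
  to consistent pairs. For such a decoupled operator both components of the stable operator are
  meets of pre-fixpoints of \<open>T\<close>, so the least fixpoint of \<open>T\<close> is its only relevant fixpoint.\<close>

section \<open>Decoupled approximating operators\<close>

text \<open>Decoupling is demanded only on consistent pairs \<open>x \<sqsubseteq> y\<close>:
  three-valued evaluation splits there, and \<open>down\<close> and \<open>up\<close> apply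
  \<open>A\<close> only to such pairs.\<close>

locale decoupled_operator = complete_lattice L for L :: "'a gorder" (structure) +
  fixes T :: "'a \<Rightarrow> 'a" and A :: "'a \<times> 'a \<Rightarrow> 'a \<times> 'a"
  assumes T_mono: "Mono T" and T_closed: "T \<in> carrier L \<rightarrow> carrier L"
    and A_eq: "\<lbrakk>x \<in> carrier L; y \<in> carrier L; x \<sqsubseteq> y\<rbrakk> \<Longrightarrow> A (x, y) = (T x, T y)"
begin

lemma LFP_eq: "T (LFP T) = LFP T"
  using LFP_unfold[OF T_mono T_closed] by simp

lemma down_eq_Inf:
  assumes "b \<in> carrier L"
  shows "down L A b = \<Sqinter>{x \<in> carrier L. x \<sqsubseteq> b \<and> T x \<sqsubseteq> x}"
proof -
  have "{x \<in> carrier L. x \<sqsubseteq> b \<and> fst (A (x, b)) \<sqsubseteq> x} = {x \<in> carrier L. x \<sqsubseteq> b \<and> T x \<sqsubseteq> x}"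
    using assms by (auto simp: A_eq)
  then show ?thesis by (simp add: down_def)
qed

lemma up_eq_Inf:
  assumes "a \<in> carrier L"
  shows "up L A a = \<Sqinter>{x \<in> carrier L. a \<sqsubseteq> x \<and> T x \<sqsubseteq> x}"
proof -
  have "{x \<in> carrier L. a \<sqsubseteq> x \<and> snd (A (a, x)) \<sqsubseteq> x} = {x \<in> carrier L. a \<sqsubseteq> x \<and> T x \<sqsubseteq> x}"
    using assms by (auto simp: A_eq)
  then show ?thesis by (simp add: up_def)
qed

text \<open>The bound on \<open>b\<close> makes \<open>LFP T\<close> itself a candidate of the meet,
  and it lies below every other pre-fixpoint.\<close>

lemma down_eq_LFP:
  assumes "b \<in> carrier L" and "LFP T \<sqsubseteq> b"
  shows "down L A b = LFP T"
  unfolding down_eq_Inf[OF assms(1)]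
proof (rule le_antisym)
  show "\<Sqinter>{x \<in> carrier L. x \<sqsubseteq> b \<and> T x \<sqsubseteq> x} \<sqsubseteq> LFP T"
    by (rule inf_lower) (auto simp: assms LFP_eq)
  show "LFP T \<sqsubseteq> \<Sqinter>{x \<in> carrier L. x \<sqsubseteq> b \<and> T x \<sqsubseteq> x}"
    by (rule inf_greatest) (auto intro: LFP_lowerbound)
qed (auto intro: inf_closed)

lemma up_LFP: "up L A (LFP T) = LFP T"
  unfolding up_eq_Inf[OF LFP_closed]
proof (rule le_antisym)
  show "\<Sqinter>{x \<in> carrier L. LFP T \<sqsubseteq> x \<and> T x \<sqsubseteq> x} \<sqsubseteq> LFP T"
    by (rule inf_lower) (auto simp: LFP_eq)
  show "LFP T \<sqsubseteq> \<Sqinter>{x \<in> carrier L. LFP T \<sqsubseteq> x \<and> T x \<sqsubseteq> x}"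
    by (rule inf_greatest) auto
qed (auto intro: inf_closed)

lemma stable_op_LFP: "stable_op L A (LFP T, LFP T) = (LFP T, LFP T)"
  by (simp add: stable_op_def down_eq_LFP up_LFP)

lemma LFP_le_up:
  assumes "a \<in> carrier L"
  shows "LFP T \<sqsubseteq> up L A a"
  unfolding up_eq_Inf[OF assms] by (rule inf_greatest) (auto intro: LFP_lowerbound)

text \<open>The second component is settled first, but only as a bound: being a value of
  \<open>up\<close>, it lies above \<open>LFP T\<close>. That is what \<open>down_eq_LFP\<close>
  needs to determine \<open>a\<close>, and feeding \<open>a\<close> back into \<open>up\<close>
  determines \<open>b\<close>.\<close>

lemma stable_fixpoint_unique:
  assumes "a \<in> carrier L" and "b \<in> carrier L" and "stable_op L A (a, b) = (a, b)"
  shows "a = LFP T" and "b = LFP T"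
proof -
  have b: "b = up L A a" and a: "a = down L A b"
    using assms(3) by (auto simp: stable_op_def)
  have "LFP T \<sqsubseteq> b"
    using LFP_le_up[OF assms(1)] b by simp
  then show "a = LFP T"
    using a down_eq_LFP[OF assms(2)] by simp
  then show "b = LFP T"
    using b up_LFP by simp
qed

lemma well_founded_fixpoint_LFP: "well_founded_fixpoint L A (LFP T, LFP T)"
  unfolding well_founded_fixpoint_def least_def
proof (intro conjI ballI)
  show "(LFP T, LFP T) \<in> {(a, b) \<in> carrier (precision L).
      (a, b) \<sqsubseteq>\<^bsub>precision L\<^esub> A (a, b) \<and> a \<sqsubseteq> down L A b \<and> stable_op L A (a, b) = (a, b)}"
    by (simp add: precision_def A_eq LFP_eq down_eq_LFP stable_op_LFP)
next
  fix w
  assume "w \<in> {(a, b) \<in> carrier (precision L).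
      (a, b) \<sqsubseteq>\<^bsub>precision L\<^esub> A (a, b) \<and> a \<sqsubseteq> down L A b \<and> stable_op L A (a, b) = (a, b)}"
  \<comment> \<open>The set is a singleton, so leastness in the precision order reduces to
    reflexivity.\<close>
  then have "w = (LFP T, LFP T)"
    using stable_fixpoint_unique by (auto simp: precision_def)
  then show "(LFP T, LFP T) \<sqsubseteq>\<^bsub>precision L\<^esub> w"
    by (simp add: precision_def)
qed auto

lemma exact_stable_fixpoint_iff: "exact_stable_fixpoint L A x \<longleftrightarrow> x = LFP T"
  using stable_op_LFP stable_fixpoint_unique(1) by (auto simp: exact_stable_fixpoint_def)

lemma least_fixpoint_LFP: "least L (LFP T) (fps L T)"
  using LFP_fixed_point[OF T_mono T_closed] LFP_least_fixed_point[OF T_mono T_closed]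
  by (auto simp: least_def fps_def)

end


section \<open>Aggregates evaluated at the endpoints\<close>

lemma ult_exact: "ult R ((S, S), d) = ((S, d) \<in> R, (S, d) \<in> R)"
  by (auto simp: ult_def dest: subset_antisym)

text \<open>The universal component is decided at the lower endpoint, the existential one at the
  upper. All sets of the interval lie in \<open>U\<close>, where monotonicity is available.\<close>

lemma ult_monotone:
  assumes "monotone_agg U R" and "S\<^sub>1 \<subseteq> S\<^sub>2" and "S\<^sub>2 \<subseteq> U"
  shows "ult R ((S\<^sub>1, S\<^sub>2), d) = ((S\<^sub>1, d) \<in> R, (S\<^sub>2, d) \<in> R)"
proof -
  have "(S', d) \<in> R" if "(S, d) \<in> R" "S \<subseteq> S'" "S' \<subseteq> S\<^sub>2" for S S'
    using assms that unfolding monotone_agg_def by (meson subset_trans)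
  then show ?thesis
    using assms(2) unfolding ult_def by (simp, blast)
qed

lemma ult_antimonotone:
  assumes "antimonotone_agg U R" and "S\<^sub>1 \<subseteq> S\<^sub>2" and "S\<^sub>2 \<subseteq> U"
  shows "ult R ((S\<^sub>1, S\<^sub>2), d) = ((S\<^sub>2, d) \<in> R, (S\<^sub>1, d) \<in> R)"
proof -
  have "(S, d) \<in> R" if "(S', d) \<in> R" "S \<subseteq> S'" "S' \<subseteq> S\<^sub>2" for S S'
    using assms that unfolding antimonotone_agg_def by (meson subset_trans)
  then show ?thesis
    using assms(2) unfolding ult_def by (simp, blast)
qed


section \<open>Three-valued evaluation of positive and negative formulas\<close>

text \<open>\<open>has_polarity Df True\<close> and \<open>has_polarity Df False\<close> say that the defined predicates occur only
  positively and only negatively, respectively; both hold if none occurs.\<close>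

definition has_polarity :: "('p \<rightharpoonup> 's list) \<Rightarrow> bool \<Rightarrow> ('p \<times> nat \<times> bool) set \<Rightarrow> bool" where
  "has_polarity Df c X \<longleftrightarrow> (\<forall>(p, n, b)\<in>X. p \<in> dom Df \<longrightarrow> \<not> b \<and> (even n \<longleftrightarrow> c))"

lemma has_polarity_Un:
  "has_polarity Df c (X\<^sub>1 \<union> X\<^sub>2) \<longleftrightarrow> has_polarity Df c X\<^sub>1 \<and> has_polarity Df c X\<^sub>2"
  by (simp add: has_polarity_def ball_Un)

lemma has_polarity_Neg:
  "has_polarity Df c (occs Sg D (Neg \<phi>)) \<longleftrightarrow> has_polarity Df (\<not> c) (occs Sg D \<phi>)"
  by (simp add: has_polarity_def split_beta) blast

lemma has_polarity_antimonotone: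
  assumes "antimonotone_sym Sg D r"
  shows "has_polarity Df c (occs Sg D (Agg r s t)) \<longleftrightarrow> has_polarity Df (\<not> c) (occs_set Sg D s)"
  using assms by (simp add: has_polarity_def split_beta) blast

text \<open>A symbol can be both monotone and anti-monotone, and \<open>occs\<close> then counts it
  as anti-monotone; parity is kept only once that case is excluded.\<close>

lemma has_polarity_monotone:
  assumes "monotone_sym Sg D r" and "\<not> antimonotone_sym Sg D r"
  shows "has_polarity Df c (occs Sg D (Agg r s t)) \<longleftrightarrow> has_polarity Df c (occs_set Sg D s)"
  using assms by (simp add: has_polarity_def split_beta)

text \<open>Every occurrence inside such an atom is marked neutral, so a polarity of either sign
  rules out defined predicates there, and then both signs hold vacuously.\<close>

lemma has_polarity_neutral:
  assumes "\<not> monotone_sym Sg D r" and "\<not> antimonotone_sym Sg D r"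
    and "has_polarity Df c (occs Sg D (Agg r s t))"
  shows "has_polarity Df c' (occs_set Sg D s)"
  using assms by (auto simp: has_polarity_def split_beta)

lemma has_polarity_positive:
  assumes pos: "positive_formula Sg D Df \<phi>"
  shows "has_polarity Df True (occs Sg D \<phi>)"
proof -
  have "\<not> b \<and> even n" if "(p, n, b) \<in> occs Sg D \<phi>" "p \<in> dom Df" for p n b
    using pos that unfolding positive_formula_def occurs_negatively_def occurs_neutrally_def
    by (cases b) (simp_all, blast+)
  then show ?thesis
    by (auto simp: has_polarity_def)
qed

lemma extend_struct_simps [simp]:
  "sdom (extend_struct D Df I) = sdom D"
  "funI (extend_struct D Df I) = funI D"
  "aggI (extend_struct D Df I) = aggI D"
  "tuples (extend_struct D Df I) = tuples D"
  "predI (extend_struct D Df I) p = (if p \<in> dom Df then {ds. (p, ds) \<in> I} else predI D p)"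
  by (auto simp: extend_struct_def tuples_def fun_eq_iff)

lemma eval_extend_struct [simp]: "eval (extend_struct D Df I) \<sigma> = eval D \<sigma>"
proof
  show "eval (extend_struct D Df I) \<sigma> t = eval D \<sigma> t" for t
    by (induction t) (simp_all cong: map_cong)
qed

lemma sig_aggs_extend_sig [simp]: "sig_aggs (extend_sig Sg Df) = sig_aggs Sg"
  by (simp add: extend_sig_def)

text \<open>Here \<open>S\<^sub>1\<close> and \<open>S\<^sub>2\<close> stand for the two-valued
  values of \<open>s\<close>. The first assumption covers every \<open>c\<close>, because an
  anti-monotone symbol uses the opposite sign and a neutral one uses both.\<close>

lemma H_ult_Agg_polarity:
  fixes D :: "('s, 'f, 'p, 'r, 'd) struct"
  assumes set: "\<And>c. has_polarity Df c (occs_set Sg D s) \<Longrightarrow>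
      H_set D Df (I\<^sub>1, I\<^sub>2) s \<sigma> = (if c then (S\<^sub>1, S\<^sub>2) else (S\<^sub>2, S\<^sub>1))"
    and le: "fst (H_set D Df (I\<^sub>1, I\<^sub>2) s \<sigma>) \<subseteq> snd (H_set D Df (I\<^sub>1, I\<^sub>2) s \<sigma>)"
    and sort: "sig_aggs Sg r = Some (ss, w)" "S\<^sub>1 \<subseteq> tuples D ss" "S\<^sub>2 \<subseteq> tuples D ss"
    and pol: "has_polarity Df c (occs Sg D (Agg r s t))"
  shows "H_ult D Df (I\<^sub>1, I\<^sub>2) (Agg r s t) \<sigma> =
    (let d = eval D \<sigma> t in
      if c then ((S\<^sub>1, d) \<in> aggI D r, (S\<^sub>2, d) \<in> aggI D r)
      else ((S\<^sub>2, d) \<in> aggI D r, (S\<^sub>1, d) \<in> aggI D r))"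
proof -
  consider "antimonotone_sym Sg D r"
    | "monotone_sym Sg D r" "\<not> antimonotone_sym Sg D r"
    | "\<not> monotone_sym Sg D r" "\<not> antimonotone_sym Sg D r"
    by blast
  then show ?thesis
  proof cases
    case 1
    then have R: "antimonotone_agg (tuples D ss) (aggI D r)"
      using sort(1) by (auto simp: antimonotone_sym_def)
    have "H_set D Df (I\<^sub>1, I\<^sub>2) s \<sigma> = (if \<not> c then (S\<^sub>1, S\<^sub>2) else (S\<^sub>2, S\<^sub>1))"
      using pol set[of "\<not> c"] by (simp only: has_polarity_antimonotone[OF 1])
    then show ?thesis
      using le sort by (auto simp: ult_antimonotone[OF R] Let_def)
  next
    case 2
    then have R: "monotone_agg (tuples D ss) (aggI D r)"
      using sort(1) by (auto simp: monotone_sym_def)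
    have "H_set D Df (I\<^sub>1, I\<^sub>2) s \<sigma> = (if c then (S\<^sub>1, S\<^sub>2) else (S\<^sub>2, S\<^sub>1))"
      using pol set[of c] by (simp only: has_polarity_monotone[OF 2])
    then show ?thesis
      using le sort by (auto simp: ult_monotone[OF R] Let_def)
  next
    case 3
    have H: "H_set D Df (I\<^sub>1, I\<^sub>2) s \<sigma> = (S\<^sub>1, S\<^sub>2)"
      using set[OF has_polarity_neutral[OF 3 pol], of True] by simp
    have "H_set D Df (I\<^sub>1, I\<^sub>2) s \<sigma> = (S\<^sub>2, S\<^sub>1)"
      using set[OF has_polarity_neutral[OF 3 pol], of False] by simp
    with H have "S\<^sub>1 = S\<^sub>2"
      by (metis prod.inject)
    with H show ?thesis
      by (simp add: ult_exact Let_def)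
  qed
qed

lemma H_ult_polarity:
  fixes \<phi> :: "('s, 'f, 'p, 'r) fm" and s :: "('s, 'f, 'p, 'r) setexp"
    and D :: "('s, 'f, 'p, 'r, 'd) struct" and Df :: "'p \<rightharpoonup> 's list"
  assumes I: "I\<^sub>1 \<subseteq> I\<^sub>2"
  defines "D\<^sub>1 \<equiv> extend_struct D Df I\<^sub>1" and "D\<^sub>2 \<equiv> extend_struct D Df I\<^sub>2"
  shows "aggregate_formula (extend_sig Sg Df) \<phi> \<Longrightarrow> has_polarity Df c (occs Sg D \<phi>) \<Longrightarrow>
      H_ult D Df (I\<^sub>1, I\<^sub>2) \<phi> \<sigma> =
        (if c then (sat D\<^sub>1 \<phi> \<sigma>, sat D\<^sub>2 \<phi> \<sigma>) else (sat D\<^sub>2 \<phi> \<sigma>, sat D\<^sub>1 \<phi> \<sigma>))"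
    and "set_expression (extend_sig Sg Df) s ss \<Longrightarrow> has_polarity Df c (occs_set Sg D s) \<Longrightarrow>
      H_set D Df (I\<^sub>1, I\<^sub>2) s \<sigma> =
        (if c then (set_val D\<^sub>1 s \<sigma>, set_val D\<^sub>2 s \<sigma>) else (set_val D\<^sub>2 s \<sigma>, set_val D\<^sub>1 s \<sigma>))"
proof (induction \<phi> and s arbitrary: c \<sigma> and c \<sigma> ss)
  case (Atom p ts)
  then show ?case
    by (auto simp: Let_def D\<^sub>1_def D\<^sub>2_def has_polarity_def)
next
  case (Agg r s t)
  then obtain ss w where ss: "sig_aggs Sg r = Some (ss, w)"
    "set_expression (extend_sig Sg Df) s ss"
    by auto
  \<comment> \<open>Sortedness puts both values inside the domain of the aggregate relation, to
    which its monotonicity properties are relative.\<close>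
  have sub: "set_val D\<^sub>1 s \<sigma> \<subseteq> tuples D ss" "set_val D\<^sub>2 s \<sigma> \<subseteq> tuples D ss"
    using ss(2) by (cases s; auto simp: D\<^sub>1_def D\<^sub>2_def)+
  show ?case
    using H_ult_Agg_polarity[OF Agg.IH[OF ss(2)] H_in_THREE(2)[OF I] ss(1) sub Agg.prems(2)]
    by (simp add: Let_def D\<^sub>1_def D\<^sub>2_def)
next
  case (Neg \<phi>)
  then show ?case
    by (simp only: has_polarity_Neg aggregate_formula.simps) simp
next
  case (SetExp xs \<phi>)
  have IH: "H_ult D Df (I\<^sub>1, I\<^sub>2) \<phi> \<tau> =
      (if c then (sat D\<^sub>1 \<phi> \<tau>, sat D\<^sub>2 \<phi> \<tau>) else (sat D\<^sub>2 \<phi> \<tau>, sat D\<^sub>1 \<phi> \<tau>))" for \<tau>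
    using SetExp by simp
  \<comment> \<open>Since the value \<open>(True, False)\<close> cannot occur, being true amounts to
    a true first component and being not false to a true second component. This turns
    \<open>H_set\<close> into a pair of two-valued sets.\<close>
  have "if c then sat D\<^sub>1 \<phi> \<tau> \<longrightarrow> sat D\<^sub>2 \<phi> \<tau> else sat D\<^sub>2 \<phi> \<tau> \<longrightarrow> sat D\<^sub>1 \<phi> \<tau>" for \<tau>
    using H_in_THREE(1)[OF I, of D Df \<phi> \<tau>] by (auto simp: IH THREE_def split: if_splits)
  then show ?case
    by (auto simp: IH D\<^sub>1_def D\<^sub>2_def split: if_splits)
qed (auto simp: has_polarity_Un prod_eq_iff fst_Inf snd_Inf fst_Sup snd_Sup image_image
       D\<^sub>1_def D\<^sub>2_def)


section \<open>Definite programs\<close>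

lemma eval_in_sdom:
  assumes D: "is_struct Sg D"
  shows "has_sort Sg t w \<Longrightarrow> (\<And>x. x \<in> fv_tm t \<Longrightarrow> \<sigma> x \<in> sdom D (snd x)) \<Longrightarrow> eval D \<sigma> t \<in> sdom D w"
proof (induction t arbitrary: w)
  case (Var x)
  then show ?case
    by (auto elim: has_sort.cases)
next
  case (Fun f ts)
  from Fun.prems(1) obtain ss where ss: "sig_funs Sg f = Some (ss, w)"
    "list_all2 (has_sort Sg) ts ss"
    by (cases rule: has_sort.cases) auto
  have "list_all2 (\<lambda>d s. d \<in> sdom D s) (map (eval D \<sigma>) ts) ss"
    unfolding list_all2_map1
    by (rule list.rel_mono_strong[OF ss(2)]) (rule Fun.IH, assumption+, rule Fun.prems(2), auto)
  then show ?case
    using D ss(1) by (force simp: is_struct_def tuples_def)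
qed

lemma inst_head_in_base:
  assumes D: "is_struct Sg D" and P: "aggregate_program Sg Df P"
    and A: "(A, \<phi>, \<sigma>) \<in> inst D P"
  shows "A \<in> base D Df"
proof -
  from A obtain p ts where A_eq: "A = (p, map (eval D \<sigma>) ts)" and rule: "((p, ts), \<phi>) \<in> P"
    and \<sigma>: "\<sigma> \<in> (\<Pi>\<^sub>E x \<in> fv_rule ((p, ts), \<phi>). sdom D (snd x))"
    unfolding inst_def by blast
  from P rule obtain ss where ss: "Df p = Some ss" "list_all2 (has_sort Sg) ts ss"
    unfolding aggregate_program_def by blast
  have "list_all2 (\<lambda>d s. d \<in> sdom D s) (map (eval D \<sigma>) ts) ss"
    unfolding list_all2_map1
    by (rule list.rel_mono_strong[OF ss(2)])
      (rule eval_in_sdom[OF D], assumption, rule PiE_mem[OF \<sigma>], auto)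
  then show ?thesis
    using ss(1) by (simp add: A_eq base_def tuples_def)
qed

text \<open>\<open>\<Phi>_ult\<close> is cut down to the base by definition, \<open>T_op\<close> is
  not. Their agreement, and \<open>T_op\<close> acting on the powerset lattice, rest on this
  inclusion.\<close>

lemma T_op_subset_base:
  assumes "is_struct Sg D" and "aggregate_program Sg Df P"
  shows "T_op D Df P I \<subseteq> base D Df"
  using inst_head_in_base[OF assms] by (auto simp: T_op_def)

lemma H_ult_definite:
  assumes P: "definite_program Sg D Df P" and I: "I\<^sub>1 \<subseteq> I\<^sub>2" and A: "(A, \<phi>, \<sigma>) \<in> inst D P"
  shows "H_ult D Df (I\<^sub>1, I\<^sub>2) \<phi> \<sigma> =
    (sat (extend_struct D Df I\<^sub>1) \<phi> \<sigma>, sat (extend_struct D Df I\<^sub>2) \<phi> \<sigma>)"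
proof -
  from A obtain p ts where rule: "((p, ts), \<phi>) \<in> P"
    unfolding inst_def by blast
  with P have "aggregate_formula (extend_sig Sg Df) \<phi>" "has_polarity Df True (occs Sg D \<phi>)"
    using has_polarity_positive unfolding definite_program_def aggregate_program_def by blast+
  from H_ult_polarity(1)[OF I this] show ?thesis
    by simp
qed

lemma T_op_mono:
  assumes P: "definite_program Sg D Df P" and I: "I\<^sub>1 \<subseteq> I\<^sub>2"
  shows "T_op D Df P I\<^sub>1 \<subseteq> T_op D Df P I\<^sub>2"
proof -
  \<comment> \<open>The two truth values form a value in \<open>THREE\<close>, so monotonicity of
    satisfaction needs no further induction.\<close>
  have "sat (extend_struct D Df I\<^sub>1) \<phi> \<sigma> \<longrightarrow> sat (extend_struct D Df I\<^sub>2) \<phi> \<sigma>"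
    if "(A, \<phi>, \<sigma>) \<in> inst D P" for A \<phi> \<sigma>
    using H_in_THREE(1)[OF I, of D Df \<phi> \<sigma>] H_ult_definite[OF P I that] by (auto simp: THREE_def)
  then show ?thesis
    unfolding T_op_def by blast
qed

lemma \<Phi>_ult_definite:
  assumes D: "is_struct Sg D" and P: "definite_program Sg D Df P" and I: "I\<^sub>1 \<subseteq> I\<^sub>2"
  shows "\<Phi>_ult D Df P (I\<^sub>1, I\<^sub>2) = (T_op D Df P I\<^sub>1, T_op D Df P I\<^sub>2)"
proof -
  let ?V = "\<lambda>A. {H_ult D Df (I\<^sub>1, I\<^sub>2) \<phi> \<sigma> | \<phi> \<sigma>. (A, \<phi>, \<sigma>) \<in> inst D P}"
  have P': "aggregate_program Sg Df P"
    using P by (simp add: definite_program_def)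
  \<comment> \<open>Joins are componentwise and a join in \<open>bool\<close> is existence, so each
    component asks for one rule instance with a satisfied body; no instance gives false.\<close>
  have Sup: "fst (Sup V) \<longleftrightarrow> (\<exists>v\<in>V. fst v)" "snd (Sup V) \<longleftrightarrow> (\<exists>v\<in>V. snd v)"
    for V :: "(bool \<times> bool) set"
    by (simp_all add: fst_Sup snd_Sup)
  have "fst (Sup (?V A)) \<longleftrightarrow> (\<exists>\<phi> \<sigma>. (A, \<phi>, \<sigma>) \<in> inst D P \<and> fst (H_ult D Df (I\<^sub>1, I\<^sub>2) \<phi> \<sigma>))"
    and "snd (Sup (?V A)) \<longleftrightarrow> (\<exists>\<phi> \<sigma>. (A, \<phi>, \<sigma>) \<in> inst D P \<and> snd (H_ult D Df (I\<^sub>1, I\<^sub>2) \<phi> \<sigma>))" for A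
    unfolding Sup by blast+
  then have "fst (Sup (?V A)) \<longleftrightarrow> A \<in> T_op D Df P I\<^sub>1" and "snd (Sup (?V A)) \<longleftrightarrow> A \<in> T_op D Df P I\<^sub>2"
    for A
    by (simp_all add: T_op_def H_ult_definite[OF P I] cong: conj_cong)
  then show ?thesis
    using T_op_subset_base[OF D P', of I\<^sub>1] T_op_subset_base[OF D P', of I\<^sub>2]
    by (auto simp: \<Phi>_ult_def Let_def)
qed

theorem theorem7:
  fixes Sg :: "('s, 'f, 'p, 'r) aggsig"
    and D :: "('s, 'f, 'p, 'r, 'd) struct"
    and Df :: "'p \<rightharpoonup> 's list"
    and P :: "('s, 'f, 'p, 'r) rule set"
  assumes "aggregate_signature Sg"
    and "is_struct Sg D"
    and "defined_predicates Sg Df"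
    and "definite_program Sg D Df P"
  shows "\<exists>M. ult_well_founded_model D Df P (M, M) \<and>
    (\<forall>N. ult_stable_model D Df P N \<longleftrightarrow> N = M) \<and>
    least (interp_lattice D Df) M (fps (interp_lattice D Df) (T_op D Df P))"
proof -
  have "complete_lattice (interp_lattice D Df)"
    unfolding interp_lattice_def by (rule powerset_is_complete_lattice)
  then interpret complete_lattice "interp_lattice D Df" .
  have sub: "T_op D Df P I \<subseteq> base D Df" for I
    using assms(4) by (intro T_op_subset_base[OF assms(2)]) (simp add: definite_program_def)
  interpret decoupled_operator "interp_lattice D Df" "T_op D Df P" "\<Phi>_ult D Df P"
  proof
    show "Mono\<^bsub>interp_lattice D Df\<^esub> (T_op D Df P)"
      using T_op_mono[OF assms(4)]
      by (intro isotoneI weak_partial_order_axioms) (simp add: interp_lattice_def)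
    show "T_op D Df P \<in> carrier (interp_lattice D Df) \<rightarrow> carrier (interp_lattice D Df)"
      using sub by (simp add: interp_lattice_def)
    show "\<Phi>_ult D Df P (x, y) = (T_op D Df P x, T_op D Df P y)"
      if "x \<sqsubseteq>\<^bsub>interp_lattice D Df\<^esub> y" for x y
      using \<Phi>_ult_definite[OF assms(2,4)] that by (simp add: interp_lattice_def)
  qed
  show ?thesis
    unfolding ult_well_founded_model_def ult_stable_model_def
    using well_founded_fixpoint_LFP exact_stable_fixpoint_iff least_fixpoint_LFP by blast
qed

end
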